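(* The cycle $C_5$ is the only unicyclic graph that is a Kirchhoff Šoltés graph: a connected graph $G$ containing exactly one cycle satisfies $Kf(G)=Kf(G-v)$ for all $v\in V(G)$ (with every $G-v$ connected) if and only if $G\cong C_5$.
   Context: All graphs are finite, simple, undirected and connected. A unicyclic graph is a connected graph containing exactly one cycle. For vertices $a,b$ of a connected graph $G$, the resistance distance $\Omega_G(a,b)$ is the effective resistance between $a$ and $b$ in the electrical network obtained from $G$ by replacing each edge by a unit resistor; equivalently $\Omega_G(a,b)=(e_a-e_b)^{T}L^{\dagger}(e_a-e_b)$, where $L$ is the Laplacian matrix of $G$, $L^{\dagger}$ its Moore–Penrose inverse, and $e_a$ the standard unit vector indexed by $a$. The Kirchhoff index of a connected graph $G$ is $Kf(G)=\sum_{\{u,v\}\subseteq V(G)}\Omega_G(u,v)$, the sum over unordered pairs of distinct vertices. $G-v$ denotes the graph obtained from $G$ by deleting the vertex $v$ and its incident edges. A vertex $v$ of $G$ is good if $G-v$ is connected and $Kf(G)=Kf(G-v)$ (cut vertices are not good). A Kirchhoff Šoltés graph is a graph all of whose vertices are good. *)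

theory Defs
  imports Complex_Main "Graph_Theory.Graph_Theory"
begin

text \<open>
  A finite simple undirected graph is a \<^term>\<open>graph\<close> of the Graph_Theory library, i.e. a finite
  symmetric digraph without loops and parallel arcs: an undirected edge is a pair of opposite arcs.
\<close>

text \<open>
  The closed walk \<open>a, b, a\<close> is a cycle of the symmetric digraph but not of the undirected graph,
  hence the bound on the length. Cycles are identified with their sets of undirected edges, so that
  the choice of starting vertex and orientation is immaterial.
\<close>

definition undirected_cycles :: "('a, 'b) pre_digraph \<Rightarrow> 'a set set set" where
  "undirected_cycles G =
     {(\<lambda>e. {tail G e, head G e}) ` set p | p. pre_digraph.cycle G p \<and> 3 \<le> length p}"

definition unicyclic :: "('a, 'b) pre_digraph \<Rightarrow> bool" where
  "unicyclic G \<longleftrightarrow> Digraph_Component.connected G \<and> (\<exists>!C. C \<in> undirected_cycles G)"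

definition cycle_graph :: "nat \<Rightarrow> (nat, nat \<times> nat) pre_digraph" where
  "cycle_graph n = with_proj \<lparr>
     pverts = {..<n},
     parcs = {(i, j). i < n \<and> j < n \<and> (j = Suc i mod n \<or> i = Suc j mod n)}\<rparr>"

text \<open>
  Matrices with rows and columns indexed by a finite set \<open>V\<close> are functions of two arguments.
  The Moore--Penrose inverse is made unique as a function by requiring it to vanish outside
  \<open>V \<times> V\<close>.
\<close>

definition mat_mul :: "'a set \<Rightarrow> ('a \<Rightarrow> 'a \<Rightarrow> real) \<Rightarrow> ('a \<Rightarrow> 'a \<Rightarrow> real) \<Rightarrow> 'a \<Rightarrow> 'a \<Rightarrow> real" where
  "mat_mul V A B = (\<lambda>i j. \<Sum>k\<in>V. A i k * B k j)"

definition is_moore_penrose :: "'a set \<Rightarrow> ('a \<Rightarrow> 'a \<Rightarrow> real) \<Rightarrow> ('a \<Rightarrow> 'a \<Rightarrow> real) \<Rightarrow> bool" where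
  "is_moore_penrose V A X \<longleftrightarrow>
     (\<forall>i j. i \<notin> V \<or> j \<notin> V \<longrightarrow> X i j = 0) \<and>
     (\<forall>i\<in>V. \<forall>j\<in>V.
        mat_mul V (mat_mul V A X) A i j = A i j \<and>
        mat_mul V (mat_mul V X A) X i j = X i j \<and>
        mat_mul V A X i j = mat_mul V A X j i \<and>
        mat_mul V X A i j = mat_mul V X A j i)"

definition moore_penrose :: "'a set \<Rightarrow> ('a \<Rightarrow> 'a \<Rightarrow> real) \<Rightarrow> 'a \<Rightarrow> 'a \<Rightarrow> real" where
  "moore_penrose V A = (THE X. is_moore_penrose V A X)"

text \<open>In a symmetric digraph the out-degree is the degree of the undirected graph.\<close>

definition laplacian :: "('a, 'b) pre_digraph \<Rightarrow> 'a \<Rightarrow> 'a \<Rightarrow> real" where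
  "laplacian G i j =
     (if i = j then real (out_degree G i) else if i \<rightarrow>\<^bsub>G\<^esub> j then - 1 else 0)"

definition unit_vec :: "'a \<Rightarrow> 'a \<Rightarrow> real" where
  "unit_vec a i = (if i = a then 1 else 0)"

definition resistance_distance :: "('a, 'b) pre_digraph \<Rightarrow> 'a \<Rightarrow> 'a \<Rightarrow> real" where
  "resistance_distance G a b =
     (\<Sum>i\<in>verts G. \<Sum>j\<in>verts G.
        (unit_vec a i - unit_vec b i) * moore_penrose (verts G) (laplacian G) i j
          * (unit_vec a j - unit_vec b j))"

lemma resistance_distance_commute: "resistance_distance G a b = resistance_distance G b a"
  unfolding resistance_distance_def by (intro sum.cong refl) (simp add: algebra_simps)

text \<open>
  The sum over unordered pairs of distinct vertices: every such pair occurs twice below, with the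
  same summand by \<open>resistance_distance_commute\<close>.
\<close>

definition kirchhoff_index :: "('a, 'b) pre_digraph \<Rightarrow> real" where
  "kirchhoff_index G = (\<Sum>u\<in>verts G. \<Sum>v\<in>verts G - {u}. resistance_distance G u v) / 2"

definition good_vertex :: "('a, 'b) pre_digraph \<Rightarrow> 'a \<Rightarrow> bool" where
  "good_vertex G v \<longleftrightarrow>
     Digraph_Component.connected (pre_digraph.del_vert G v) \<and>
     kirchhoff_index G = kirchhoff_index (pre_digraph.del_vert G v)"

definition kirchhoff_soltes_graph :: "('a, 'b) pre_digraph \<Rightarrow> bool" where
  "kirchhoff_soltes_graph G \<longleftrightarrow> (\<forall>v\<in>verts G. good_vertex G v)"

end

theory Submission
  imports Defs
begin

text \<open>
  Suppose that \<open>G\<close> is unicyclic and no vertex is a cut vertex. If \<open>c\<close> has two neighbours \<open>w\<close> and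
  \<open>c'\<close>, they are joined in \<open>G - c\<close>, so the edge \<open>{c, w}\<close> lies on a cycle, hence on the only one.
  Thus a vertex of the cycle has no neighbours but its two neighbours on the cycle, and \<open>G\<close> is the
  cycle \<open>C\<^sub>n\<close>. Deleting a vertex leaves the path \<open>P\<^bsub>n-1\<^esub>\<close>. From explicit solutions of
  \<open>L h\<^sub>b = e\<^sub>b - \<one>/n\<close> on cycles and paths one reads off \<open>Kf(C\<^sub>n) = n(n\<^sup>2 - 1)/12\<close> and
  \<open>Kf(P\<^sub>m) = m(m\<^sup>2 - 1)/6\<close>, and \<open>Kf(C\<^sub>n) = Kf(P\<^bsub>n-1\<^esub>)\<close> for \<open>n \<ge> 3\<close> only if \<open>n = 5\<close>.
\<close>

section \<open>Resistance distances from potentials\<close>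

lemma mat_mul_assoc:
  assumes "finite V"
  shows "mat_mul V (mat_mul V A B) C = mat_mul V A (mat_mul V B C)"
proof (intro ext)
  fix i j
  have "(\<Sum>k\<in>V. (\<Sum>l\<in>V. A i l * B l k) * C k j) = (\<Sum>k\<in>V. \<Sum>l\<in>V. A i l * (B l k * C k j))"
    by (simp add: sum_distrib_right mult.assoc)
  also have "\<dots> = (\<Sum>l\<in>V. \<Sum>k\<in>V. A i l * (B l k * C k j))"
    by (rule sum.swap)
  finally show "mat_mul V (mat_mul V A B) C i j = mat_mul V A (mat_mul V B C) i j"
    by (simp add: mat_mul_def sum_distrib_left)
qed

lemma mat_mul_cong:
  assumes "\<And>k. k \<in> V \<Longrightarrow> A i k = A' i k" and "\<And>k. k \<in> V \<Longrightarrow> B k j = B' k j"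
  shows "mat_mul V A B i j = mat_mul V A' B' i j"
  unfolding mat_mul_def using assms by (auto intro!: sum.cong)

text \<open>\<open>A X\<close> and \<open>A Y\<close> are symmetric projections onto the same range,
  hence equal; likewise \<open>X A = Y A\<close>. Then \<open>X = X A X = Y A X = Y A Y = Y\<close>.
  The Penrose equations only speak about entries in \<open>V\<close>; elsewhere both inverses are
  0.\<close>

lemma moore_penrose_unique:
  assumes fin: "finite V" and X: "is_moore_penrose V A X" and Y: "is_moore_penrose V A Y"
  shows "X = Y"
proof -
  have AX: "mat_mul V A X i j = mat_mul V A Y i j" if "i \<in> V" "j \<in> V" for i j
  proof -
    have "mat_mul V A X i j = mat_mul V (mat_mul V (mat_mul V A Y) A) X i j"
      using Y that by (intro mat_mul_cong) (auto simp: is_moore_penrose_def)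
    also have "\<dots> = mat_mul V (mat_mul V A Y) (mat_mul V A X) i j"
      by (simp add: mat_mul_assoc fin)
    \<comment> \<open>Transposing a product of two symmetric matrices reverses the factors, after
      which \<open>A X A = A\<close> applies.\<close>
    also have "\<dots> = mat_mul V (mat_mul V A X) (mat_mul V A Y) j i"
      using X Y that unfolding mat_mul_def[of V "mat_mul V A X"] mat_mul_def[of V "mat_mul V A Y"]
      by (intro sum.cong) (auto simp: is_moore_penrose_def)
    also have "\<dots> = mat_mul V (mat_mul V (mat_mul V A X) A) Y j i"
      by (simp add: mat_mul_assoc fin)
    also have "\<dots> = mat_mul V A Y j i"
      using X that by (intro mat_mul_cong) (auto simp: is_moore_penrose_def)
    also have "\<dots> = mat_mul V A Y i j"
      using Y that by (auto simp: is_moore_penrose_def)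
    finally show ?thesis .
  qed
  have XA: "mat_mul V X A i j = mat_mul V Y A i j" if "i \<in> V" "j \<in> V" for i j
  proof -
    have "mat_mul V X A i j = mat_mul V X (mat_mul V (mat_mul V A Y) A) i j"
      using Y that by (intro mat_mul_cong) (auto simp: is_moore_penrose_def)
    also have "\<dots> = mat_mul V (mat_mul V X A) (mat_mul V Y A) i j"
      by (simp add: mat_mul_assoc fin)
    also have "\<dots> = mat_mul V (mat_mul V Y A) (mat_mul V X A) j i"
      using X Y that unfolding mat_mul_def[of V "mat_mul V X A"] mat_mul_def[of V "mat_mul V Y A"]
      by (intro sum.cong) (auto simp: is_moore_penrose_def)
    also have "\<dots> = mat_mul V Y (mat_mul V (mat_mul V A X) A) j i"
      by (simp add: mat_mul_assoc fin)
    also have "\<dots> = mat_mul V Y A j i"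
      using X that by (intro mat_mul_cong) (auto simp: is_moore_penrose_def)
    also have "\<dots> = mat_mul V Y A i j"
      using Y that by (auto simp: is_moore_penrose_def)
    finally show ?thesis .
  qed
  have "X i j = Y i j" if "i \<in> V" "j \<in> V" for i j
  proof -
    have "X i j = mat_mul V (mat_mul V X A) X i j"
      using X that by (auto simp: is_moore_penrose_def)
    also have "\<dots> = mat_mul V (mat_mul V Y A) X i j"
      by (rule mat_mul_cong) (simp_all add: XA that)
    also have "\<dots> = mat_mul V Y (mat_mul V A X) i j"
      by (simp add: mat_mul_assoc fin)
    also have "\<dots> = mat_mul V Y (mat_mul V A Y) i j"
      by (rule mat_mul_cong) (simp_all add: AX that)
    also have "\<dots> = Y i j"
      using Y that by (auto simp: is_moore_penrose_def mat_mul_assoc[OF fin])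
    finally show ?thesis .
  qed
  moreover have "X i j = Y i j" if "i \<notin> V \<or> j \<notin> V" for i j
    using X Y that by (auto simp: is_moore_penrose_def)
  ultimately show ?thesis by blast
qed

lemma moore_penrose_eqI:
  "finite V \<Longrightarrow> is_moore_penrose V A X \<Longrightarrow> moore_penrose V A = X"
  unfolding moore_penrose_def by (blast intro: the_equality moore_penrose_unique)

text \<open>
  If \<open>L h\<^sub>b = e\<^sub>b - \<one>/n\<close> for every \<open>b\<close>, then normalising each \<open>h\<^sub>b\<close> to mean zero gives
  the columns of the Moore--Penrose inverse.
\<close>

lemma moore_penrose_of_potentials:
  assumes fin: "finite V" and ne: "V \<noteq> {}"
    and sym: "\<And>i j. i \<in> V \<Longrightarrow> j \<in> V \<Longrightarrow> L i j = L j i"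
    and zero: "\<And>i. i \<in> V \<Longrightarrow> (\<Sum>k\<in>V. L i k) = 0"
    and h: "\<And>i b. i \<in> V \<Longrightarrow> b \<in> V \<Longrightarrow>
      (\<Sum>k\<in>V. L i k * h b k) = (if i = b then 1 else 0) - 1 / real (card V)"
  shows "moore_penrose V L =
    (\<lambda>i j. if i \<in> V \<and> j \<in> V then h j i - (\<Sum>k\<in>V. h j k) / real (card V) else 0)"
    (is "_ = ?X")
proof (rule moore_penrose_eqI[OF fin])
  let ?n = "real (card V)"
  \<comment> \<open>The orthogonal projection onto vectors of sum zero. It fixes the columns of
    \<open>?X\<close>, which are normalised to sum zero, and the columns of
    \<open>L\<close>.\<close>
  let ?P = "\<lambda>i j. (if i = j then 1 else 0) - 1 / ?n"
  have n: "?n \<noteq> 0" using fin ne by simp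
  have LX: "mat_mul V L ?X i j = ?P i j" if "i \<in> V" "j \<in> V" for i j
  proof -
    have "mat_mul V L ?X i j = (\<Sum>k\<in>V. L i k * h j k - L i k * ((\<Sum>k\<in>V. h j k) / ?n))"
      unfolding mat_mul_def using that by (intro sum.cong) (auto simp: right_diff_distrib)
    also have "\<dots> = ?P i j"
      using h[OF that] zero[OF that(1)] by (simp only: sum_subtractf flip: sum_distrib_right)
    finally show ?thesis .
  qed
  have X0: "(\<Sum>k\<in>V. ?X k j) = 0" if "j \<in> V" for j
    using that n by (simp add: sum_subtractf)
  have P_sum: "(\<Sum>k\<in>V. ?P i k * x k) = x i - (\<Sum>k\<in>V. x k) / ?n" if "i \<in> V" for i x
  proof -
    have "(\<Sum>k\<in>V. ?P i k * x k) = (\<Sum>k\<in>V. (if i = k then x k else 0) - x k / ?n)"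
      by (intro sum.cong) (auto simp: left_diff_distrib)
    then show ?thesis
      using that fin by (simp add: sum_subtractf sum_divide_distrib)
  qed
  \<comment> \<open>Since \<open>P = L X\<close> is symmetric,
    \<open>X = P X = (L X)^T X = X^T L X\<close>. This form shows that \<open>X\<close> inherits
    symmetry from \<open>L\<close>, although nothing symmetric was assumed about
    \<open>h\<close>.\<close>
  have X_quad: "?X i j = (\<Sum>k\<in>V. \<Sum>l\<in>V. L k l * ?X l i * ?X k j)" if "i \<in> V" "j \<in> V" for i j
  proof -
    have "?X i j = (\<Sum>k\<in>V. ?P i k * ?X k j)"
      using P_sum[OF that(1), of "\<lambda>k. ?X k j"] X0[OF that(2)] by simp
    also have "\<dots> = (\<Sum>k\<in>V. mat_mul V L ?X k i * ?X k j)"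
      by (intro sum.cong refl) (simp only: LX that eq_commute[of i])
    finally show ?thesis
      by (simp only: mat_mul_def sum_distrib_right)
  qed
  have X_sym: "?X i j = ?X j i" if "i \<in> V" "j \<in> V" for i j
  proof -
    have "(\<Sum>k\<in>V. \<Sum>l\<in>V. L k l * ?X l i * ?X k j) = (\<Sum>l\<in>V. \<Sum>k\<in>V. L k l * ?X l i * ?X k j)"
      by (rule sum.swap)
    also have "\<dots> = (\<Sum>l\<in>V. \<Sum>k\<in>V. L l k * ?X k j * ?X l i)"
      by (intro sum.cong refl) (simp only: sym mult_ac)
    finally show ?thesis
      by (simp only: X_quad[OF that] X_quad[OF that(2,1)])
  qed
  have XL: "mat_mul V ?X L i j = ?P i j" if "i \<in> V" "j \<in> V" for i j
  proof -
    have "mat_mul V ?X L i j = mat_mul V L ?X j i"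
      unfolding mat_mul_def
      by (intro sum.cong refl, subst X_sym) (use that sym in \<open>auto simp: mult_ac\<close>)
    then show ?thesis using LX[OF that(2,1)] by simp
  qed
  have "mat_mul V (mat_mul V L ?X) L i j = L i j" if "i \<in> V" "j \<in> V" for i j
  proof -
    have "mat_mul V (mat_mul V L ?X) L i j = (\<Sum>k\<in>V. ?P i k * L k j)"
      unfolding mat_mul_def[of V "mat_mul V L ?X"] by (intro sum.cong refl) (simp only: LX that)
    moreover have "(\<Sum>k\<in>V. L k j) = 0"
      using zero[OF that(2)] sym that by (metis (mono_tags, lifting) sum.cong)
    ultimately show ?thesis by (simp add: P_sum[OF that(1)])
  qed
  moreover have "mat_mul V (mat_mul V ?X L) ?X i j = ?X i j" if "i \<in> V" "j \<in> V" for i j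
  proof -
    have "mat_mul V (mat_mul V ?X L) ?X i j = (\<Sum>k\<in>V. ?P i k * ?X k j)"
      unfolding mat_mul_def[of V "mat_mul V ?X L"] by (intro sum.cong refl) (simp only: XL that)
    then show ?thesis 
      using P_sum[OF that(1), of "\<lambda>k. ?X k j"] X0[OF that(2)] by simp
  qed
  ultimately show "is_moore_penrose V L ?X"
    unfolding is_moore_penrose_def using LX XL by auto
qed

text \<open>This is the net current leaving \<open>i\<close> under the potential \<open>x\<close>.
  As there are no parallel arcs, \<open>head G\<close> is a bijection from the arcs leaving
  \<open>i\<close> to its neighbours, so the degree counts neighbours.\<close>

lemma (in graph) sum_laplacian_mult:
  assumes i: "i \<in> verts G"
  shows "(\<Sum>k\<in>verts G. laplacian G i k * x k) = (\<Sum>k | k \<in> verts G \<and> i \<rightarrow>\<^bsub>G\<^esub> k. x i - x k)"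
proof -
  let ?N = "{k \<in> verts G. i \<rightarrow>\<^bsub>G\<^esub> k}"
  have "bij_betw (head G) (out_arcs G i) ?N"
    unfolding bij_betw_def
  proof (intro conjI)
    show "inj_on (head G) (out_arcs G i)"
      by (auto simp: inj_on_def arc_to_ends_def intro!: no_multi_arcs)
    show "head G ` out_arcs G i = ?N"
      by (auto simp: arcs_ends_conv image_iff)
  qed
  then have deg: "out_degree G i = card ?N"
    unfolding out_degree_def by (rule bij_betw_same_card)
  have "(\<Sum>k\<in>verts G. laplacian G i k * x k) =
    (\<Sum>k\<in>verts G. (if i = k then real (out_degree G i) * x k else 0) - (if i \<rightarrow>\<^bsub>G\<^esub> k then x k else 0))"
    using adj_not_same by (intro sum.cong) (auto simp: laplacian_def)
  also have "\<dots> = real (card ?N) * x i - (\<Sum>k\<in>?N. x k)"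
    using i by (simp add: sum_subtractf deg sum.inter_filter)
  finally show ?thesis by (simp add: sum_subtractf)
qed

text \<open>The mean subtracted from \<open>h b\<close> is constant along its column and cancels in
  the four-term expression, so potentials may be chosen up to an additive constant.\<close>

lemma (in graph) resistance_distance_of_potentials:
  assumes h: "\<And>i b. i \<in> verts G \<Longrightarrow> b \<in> verts G \<Longrightarrow>
      (\<Sum>k | k \<in> verts G \<and> i \<rightarrow>\<^bsub>G\<^esub> k. h b i - h b k) = (if i = b then 1 else 0) - 1 / real (card (verts G))"
    and a: "a \<in> verts G" and b: "b \<in> verts G"
  shows "resistance_distance G a b = h a a - h a b - h b a + h b b"
proof -
  let ?V = "verts G" and ?X = "moore_penrose (verts G) (laplacian G)"
  have adj: "i \<rightarrow>\<^bsub>G\<^esub> j \<longleftrightarrow> j \<rightarrow>\<^bsub>G\<^esub> i" for i j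
    using arcs_ends_symmetric[OF sym_arcs] by blast
  have X: "?X = (\<lambda>i j. if i \<in> ?V \<and> j \<in> ?V then h j i - (\<Sum>k\<in>?V. h j k) / real (card ?V) else 0)"
  proof (rule moore_penrose_of_potentials)
    show "laplacian G i j = laplacian G j i" for i j
      using adj by (auto simp: laplacian_def)
    show "(\<Sum>k\<in>?V. laplacian G i k) = 0" if "i \<in> ?V" for i
      using sum_laplacian_mult[OF that, of "\<lambda>_. 1"] by simp
    show "(\<Sum>k\<in>?V. laplacian G i k * h b k) = (if i = b then 1 else 0) - 1 / real (card ?V)"
      if "i \<in> ?V" "b \<in> ?V" for i b
      using h[OF that] sum_laplacian_mult[OF that(1)] by simp
  qed (use a in auto)
  have unit: "(\<Sum>j\<in>?V. x j * (unit_vec a j - unit_vec b j)) = x a - x b" for x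
  proof -
    have "(\<Sum>j\<in>?V. x j * (unit_vec a j - unit_vec b j)) =
      (\<Sum>j\<in>?V. (if j = a then x j else 0) - (if j = b then x j else 0))"
      by (intro sum.cong) (auto simp: unit_vec_def)
    then show ?thesis using a b by (simp add: sum_subtractf)
  qed
  have "resistance_distance G a b =
    (\<Sum>i\<in>?V. (\<Sum>j\<in>?V. ?X i j * (unit_vec a j - unit_vec b j)) * (unit_vec a i - unit_vec b i))"
    unfolding resistance_distance_def by (simp add: sum_distrib_left mult_ac)
  also have "\<dots> = ?X a a - ?X a b - (?X b a - ?X b b)"
    by (simp only: unit)
  finally show ?thesis using a b by (simp add: X)
qed

lemma (in graph) kirchhoff_index_of_potentials:
  assumes f: "bij_betw f {..<n} (verts G)"
    and adj: "\<And>i j. i < n \<Longrightarrow> j < n \<Longrightarrow> f i \<rightarrow>\<^bsub>G\<^esub> f j \<longleftrightarrow> E i j"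
    and H: "\<And>i b. i < n \<Longrightarrow> b < n \<Longrightarrow>
      (\<Sum>j | j < n \<and> E i j. H b i - H b j) = (if i = b then 1 else 0) - 1 / real n"
  shows "kirchhoff_index G = (\<Sum>a<n. \<Sum>b<n. H a a - H a b - H b a + H b b) / 2"
proof -
  let ?V = "verts G"
  define g where "g = the_inv_into {..<n} f"
  define h where "h b v = H (g b) (g v)" for b v
  have inj: "inj_on f {..<n}" and img: "f ` {..<n} = ?V"
    using f by (auto simp: bij_betw_def)
  have gf[simp]: "g (f i) = i" if "i < n" for i
    using inj that by (simp add: g_def the_inv_into_f_f)
  have card: "card ?V = n"
    using bij_betw_same_card[OF f] by simp
  have "(\<Sum>k | k \<in> ?V \<and> v \<rightarrow>\<^bsub>G\<^esub> k. h b v - h b k) = (if v = b then 1 else 0) - 1 / real (card ?V)"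
    if vb: "v \<in> ?V" "b \<in> ?V" for v b
  proof -
    obtain i c where ic: "i < n" "v = f i" "c < n" "b = f c"
      using vb unfolding img[symmetric] by blast
    have eq: "{k \<in> ?V. v \<rightarrow>\<^bsub>G\<^esub> k} = f ` {j. j < n \<and> E i j}"
      unfolding img[symmetric] ic(2) using adj[OF ic(1)] by auto
    have "inj_on f {j. j < n \<and> E i j}"
      using inj by (rule inj_on_subset) auto
    then have "(\<Sum>k | k \<in> ?V \<and> v \<rightarrow>\<^bsub>G\<^esub> k. h b v - h b k) = (\<Sum>j | j < n \<and> E i j. h b v - h b (f j))"
      unfolding eq by (simp add: sum.reindex)
    also have "\<dots> = (\<Sum>j | j < n \<and> E i j. H c i - H c j)"
      by (intro sum.cong) (auto simp: h_def ic)
    also have "\<dots> = (if i = c then 1 else 0) - 1 / real n"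
      using H ic by simp
    finally show ?thesis
      using ic inj card by (auto simp: inj_on_def)
  qed
  note R = resistance_distance_of_potentials[of h, OF this]
  \<comment> \<open>The diagonal terms are 0 and may be added back.\<close>
  have "kirchhoff_index G = (\<Sum>u\<in>?V. \<Sum>v\<in>?V. resistance_distance G u v) / 2"
    unfolding kirchhoff_index_def
    by (simp add: sum_diff1 resistance_distance_def)
  also have "\<dots> = (\<Sum>a<n. \<Sum>b<n. resistance_distance G (f a) (f b)) / 2"
    using inj by (simp add: sum.reindex flip: img)
  also have "(\<Sum>a<n. \<Sum>b<n. resistance_distance G (f a) (f b)) =
      (\<Sum>a<n. \<Sum>b<n. H a a - H a b - H b a + H b b)"
  proof (intro sum.cong refl)
    fix a b assume "a \<in> {..<n}" "b \<in> {..<n}"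
    then show "resistance_distance G (f a) (f b) = H a a - H a b - H b a + H b b"
      using R[of "f a" "f b"] img by (auto simp: h_def)
  qed
  finally show ?thesis .
qed

section \<open>Kirchhoff indices of cycles and paths\<close>

text \<open>An isomorphism with the cycle reduced to its vertex map. In this form it is easily
  rotated, restricted to a path, and used as an index set for sums.\<close>

definition cyclic_enum :: "('a, 'b) pre_digraph \<Rightarrow> nat \<Rightarrow> (nat \<Rightarrow> 'a) \<Rightarrow> bool" where
  "cyclic_enum G n f \<longleftrightarrow> bij_betw f {..<n} (verts G) \<and>
     (\<forall>i<n. \<forall>j<n. f i \<rightarrow>\<^bsub>G\<^esub> f j \<longleftrightarrow> j = Suc i mod n \<or> i = Suc j mod n)"

definition path_enum :: "('a, 'b) pre_digraph \<Rightarrow> nat \<Rightarrow> (nat \<Rightarrow> 'a) \<Rightarrow> bool" where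
  "path_enum G n f \<longleftrightarrow> bij_betw f {..<n} (verts G) \<and>
     (\<forall>i<n. \<forall>j<n. f i \<rightarrow>\<^bsub>G\<^esub> f j \<longleftrightarrow> j = Suc i \<or> i = Suc j)"

lemma Suc_mod_eq_if: "i < n \<Longrightarrow> Suc i mod n = (if Suc i = n then 0 else Suc i)"
  by auto

lemma inj_on_Suc_mod: "inj_on (\<lambda>i. Suc i mod n) {..<n}"
  by (auto simp: inj_on_def Suc_mod_eq_if split: if_splits)

lemma ex_Suc_mod_eq:
  assumes "i < n"
  obtains k where "k < n" "Suc k mod n = i"
  using assms by (cases i) (auto intro: that[of "n - 1"] that[of "i - 1"])

lemma cyclic_nbrs_eq:
  assumes "3 \<le> n" "i < n"
  shows "{j. j < n \<and> (j = Suc i mod n \<or> i = Suc j mod n)} =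
    {if Suc i = n then 0 else Suc i, if i = 0 then n - 1 else i - 1}"
  using assms by (auto simp: Suc_mod_eq_if split: if_splits dest: dvd_imp_le)

text \<open>The parameter \<open>c\<close> lets one formula serve twice: \<open>c = n\<close> gives
  the cycle, and the difference of \<open>c = 1\<close> and \<open>c = 0\<close> gives the path. The
  induction adds a last row and a last column, which have equal sums.\<close>

lemma sum_mult_diff_square:
  "(\<Sum>a<m. \<Sum>b<m. \<bar>real a - real b\<bar> * (c - \<bar>real a - real b\<bar>)) =
     real m * ((real m)\<^sup>2 - 1) * (2 * c - real m) / 6"
proof (induction m)
  case 0
  show ?case by simp
next
  case (Suc m)
  let ?g = "\<lambda>a b. \<bar>real a - real b\<bar> * (c - \<bar>real a - real b\<bar>)"
  have "(\<Sum>b<k. (x - real b) * (c - (x - real b))) =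
      (\<Sum>b<k. x * (c - x) + (2 * x - c) * real b - real b ^ 2)" for x k
    by (intro sum.cong refl) (simp add: algebra_simps power2_eq_square)
  moreover have "(\<Sum>b<k. real b) = real k * (real k - 1) / 2" for k
    by (induction k) (auto simp: field_simps)
  moreover have "(\<Sum>b<k. real b ^ 2) = real k * (real k - 1) * (2 * real k - 1) / 6" for k
    by (induction k) (auto simp: field_simps power2_eq_square)
  ultimately have row: "(\<Sum>b<m. (real m - real b) * (c - (real m - real b))) =
      real m * real m * (c - real m) + (2 * real m - c) * (real m * (real m - 1) / 2)
        - real m * (real m - 1) * (2 * real m - 1) / 6"
    by (simp add: sum.distrib sum_subtractf flip: sum_distrib_left)
  have "(\<Sum>b<m. ?g m b) = (\<Sum>b<m. (real m - real b) * (c - (real m - real b)))"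
    by (intro sum.cong) auto
  moreover have "(\<Sum>a<m. ?g a m) = (\<Sum>b<m. ?g m b)"
    by (simp add: abs_minus_commute)
  ultimately show ?case
    by (simp add: sum.distrib Suc.IH row) (simp add: field_simps power2_eq_square)
qed

lemma (in graph) kirchhoff_index_cyclic:
  assumes f: "cyclic_enum G n f" and n: "3 \<le> n"
  shows "kirchhoff_index G = real n * ((real n)\<^sup>2 - 1) / 12"
proof -
  \<comment> \<open>\<open>- Q (i - b)\<close> is half the resistance distance from \<open>i\<close> to \<open>b\<close> along the two arcs of the cycle.\<close>
  define Q :: "real \<Rightarrow> real" where "Q x = - \<bar>x\<bar> * (real n - \<bar>x\<bar>) / (2 * real n)" for x
  let ?E = "\<lambda>i j. j = Suc i mod n \<or> i = Suc j mod n"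
  \<comment> \<open>The product of \<open>x\<close> and \<open>n - x\<close> is unchanged when they
    are swapped. This handles the wrap-around at the indices 0 and \<open>n - 1\<close>.\<close>
  have Q_period: "Q (x - real n) = Q x" if "0 \<le> x" "x \<le> real n" for x
    using that n by (simp add: Q_def field_simps)
  \<comment> \<open>\<open>Q x\<close> is \<open>x^2 / (2 n) - |x| / 2\<close>: the quadratic part
    contributes \<open>- 1 / n\<close> everywhere, and the kink at 0 contributes the 1. The
    condition keeps the kink out of the interior of either unit step.\<close>
  have laplace: "2 * Q x - Q (x + 1) - Q (x - 1) = (if x = 0 then 1 else 0) - 1 / real n"
    if "x = 0 \<or> x \<ge> 1 \<or> x \<le> -1" for x
    using that n by (auto simp: Q_def field_simps)
  have "kirchhoff_index G = (\<Sum>a<n. \<Sum>b<n. Q (real a - real a) - Q (real b - real a)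
      - Q (real a - real b) + Q (real b - real b)) / 2"
  proof (rule kirchhoff_index_of_potentials)
    fix i b assume ib: "i < n" "b < n"
    let ?x = "real i - real b"
    let ?s = "if Suc i = n then 0 else Suc i" and ?p = "if i = 0 then n - 1 else i - 1"
    \<comment> \<open>For \<open>n\<close> at least 3 successor and predecessor differ, so the sum
      over neighbours really has two terms.\<close>
    have "?s \<noteq> ?p" using n by auto
    then have "(\<Sum>j | j < n \<and> ?E i j. Q ?x - Q (real j - real b)) =
      2 * Q ?x - Q (real ?s - real b) - Q (real ?p - real b)"
      unfolding cyclic_nbrs_eq[OF n ib(1)] by simp
    also have "Q (real ?s - real b) = Q (?x + 1)"
    proof (cases "Suc i = n")
      case True
      then have "?x + 1 - real n = real ?s - real b" by auto
      with Q_period[of "?x + 1"] True ib show ?thesis by auto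
    qed (simp add: algebra_simps)
    also have "Q (real ?p - real b) = Q (?x - 1)"
    proof (cases "i = 0")
      case True
      then have "real ?p - real b - real n = ?x - 1" using n by auto
      moreover have "Q (real ?p - real b - real n) = Q (real ?p - real b)"
        using True ib by (intro Q_period) auto
      ultimately show ?thesis by metis
    qed (auto simp: algebra_simps of_nat_diff)
    also have "2 * Q ?x - Q (?x + 1) - Q (?x - 1) = (if i = b then 1 else 0) - 1 / real n"
      using laplace[of ?x] by (cases i b rule: linorder_cases) auto
    finally show "(\<Sum>j | j < n \<and> ?E i j. Q ?x - Q (real j - real b)) =
      (if i = b then 1 else 0) - 1 / real n" .
  qed (use f in \<open>auto simp: cyclic_enum_def\<close>)
  also have "\<dots> = (\<Sum>a<n. \<Sum>b<n. \<bar>real a - real b\<bar> * (real n - \<bar>real a - real b\<bar>) / real n) / 2"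
    using n by (intro arg_cong[of _ _ "\<lambda>x. x / 2"] sum.cong refl)
      (auto simp: Q_def abs_minus_commute field_simps)
  also have "\<dots> = real n * ((real n)\<^sup>2 - 1) / 12"
    using n by (simp add: sum_mult_diff_square flip: sum_divide_distrib)
  finally show ?thesis .
qed

lemma (in graph) kirchhoff_index_path:
  assumes f: "path_enum G n f"
  shows "kirchhoff_index G = real n * ((real n)\<^sup>2 - 1) / 6"
proof -
  \<comment> \<open>Inject one unit at \<open>b\<close> and extract \<open>1 / n\<close> at every
    vertex. The current from \<open>i\<close> to \<open>i + 1\<close> is then what enters minus what
    leaves among the vertices 0 to \<open>i\<close>, namely \<open>[b <= i] - (i + 1) / n\<close>.
    Summing these potential drops from \<open>H b 0 = 0\<close> gives the formula.\<close>
  define H :: "nat \<Rightarrow> nat \<Rightarrow> real"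
    where "H b i = real i * (real i + 1) / (2 * real n) - max (real i - real b) 0" for b i
  let ?E = "\<lambda>i j. j = Suc i \<or> i = Suc j"
  have "kirchhoff_index G = (\<Sum>a<n. \<Sum>b<n. H a a - H a b - H b a + H b b) / 2"
  proof (rule kirchhoff_index_of_potentials)
    fix i b assume ib: "i < n" "b < n"
    have split: "{j. j < n \<and> ?E i j} = {j. j = Suc i \<and> j < n} \<union> {j. i = Suc j}"
      using ib by auto
    have "(\<Sum>j | j = Suc i \<and> j < n. H b i - H b j) = (if Suc i < n then H b i - H b (Suc i) else 0)"
      by (auto simp: Collect_conv_if)
    moreover have "(\<Sum>j | i = Suc j. H b i - H b j) = (case i of 0 \<Rightarrow> 0 | Suc k \<Rightarrow> H b i - H b k)"
      by (cases i) auto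
    ultimately have "(\<Sum>j | j < n \<and> ?E i j. H b i - H b j) =
      (if Suc i < n then H b i - H b (Suc i) else 0) + (case i of 0 \<Rightarrow> 0 | Suc k \<Rightarrow> H b i - H b k)"
      unfolding split by (subst sum.union_disjoint) (auto simp: Collect_conv_if split: nat.splits)
    also have "H b i - H b (Suc i) = (if b \<le> i then 1 else 0) - (real i + 1) / real n"
      using ib by (auto simp: H_def field_simps)
    also have "(case i of 0 \<Rightarrow> 0 | Suc k \<Rightarrow> H b i - H b k) = real i / real n - (if b < i then 1 else 0)"
      using ib by (auto simp: H_def field_simps split: nat.split)
    also have "(real i + 1) / real n = real i / real n + 1 / real n"
      by (rule add_divide_distrib)
    \<comment> \<open>The last vertex has no edge to the right, but the current formula gives
      \<open>1 - n / n = 0\<close> there, so the equation is the same as at inner vertices.\<close>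
    moreover have "real i / real n + 1 / real n = 1" if "Suc i = n"
      using that by (simp add: field_simps)
    ultimately show "(\<Sum>j | j < n \<and> ?E i j. H b i - H b j) = (if i = b then 1 else 0) - 1 / real n"
      using ib by (cases "Suc i = n") auto
  qed (use f in \<open>auto simp: path_enum_def\<close>)
  \<comment> \<open>The quadratic parts cancel and the two maxima add up to the number of edges
    between \<open>a\<close> and \<open>b\<close>.\<close>
  also have "\<dots> = (\<Sum>a<n. \<Sum>b<n. \<bar>real a - real b\<bar>) / 2"
    by (intro arg_cong[of _ _ "\<lambda>x. x / 2"] sum.cong refl) (auto simp: H_def)
  also have "(\<Sum>a<n. \<Sum>b<n. \<bar>real a - real b\<bar>) =
      (\<Sum>a<n. \<Sum>b<n. \<bar>real a - real b\<bar> * (1 - \<bar>real a - real b\<bar>)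
        - \<bar>real a - real b\<bar> * (0 - \<bar>real a - real b\<bar>))"
    by (intro sum.cong refl) (simp add: algebra_simps)
  also have "\<dots> = real n * ((real n)\<^sup>2 - 1) / 3"
    by (simp only: sum_subtractf sum_mult_diff_square) (simp add: field_simps)
  finally show ?thesis by simp
qed

section \<open>Deleting a vertex of a cycle\<close>

lemma cyclic_enum_rotate:
  assumes f: "cyclic_enum G n f"
  shows "cyclic_enum G n (\<lambda>i. f ((i + k) mod n))"
proof (cases "n = 0")
  case False
  let ?r = "\<lambda>i. (i + k) mod n"
  have eq: "?r i = ?r j \<longleftrightarrow> i = j" if "i < n" "j < n" for i j
    using that
  proof (induction i j rule: linorder_wlog)
    case (le i j)
    then show ?case
      using mod_eq_dvd_iff_nat[of "i + k" "j + k" n] by (auto dest: dvd_imp_le)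
  qed auto
  have "inj_on ?r {..<n}"
    using eq by (auto simp: inj_on_def)
  moreover have "?r ` {..<n} \<subseteq> {..<n}"
    using False by auto
  ultimately have "bij_betw ?r {..<n} {..<n}"
    by (simp add: bij_betw_def endo_inj_surj)
  then have "bij_betw (f \<circ> ?r) {..<n} (verts G)"
    using f by (auto simp: cyclic_enum_def intro: bij_betw_trans)
  moreover have "f (?r i) \<rightarrow>\<^bsub>G\<^esub> f (?r j) \<longleftrightarrow> j = Suc i mod n \<or> i = Suc j mod n"
    if "i < n" "j < n" for i j
  proof -
    have "Suc (?r i) mod n = ?r (Suc i mod n)" for i
      by (simp add: mod_simps)
    then have "f (?r i) \<rightarrow>\<^bsub>G\<^esub> f (?r j) \<longleftrightarrow> ?r j = ?r (Suc i mod n) \<or> ?r i = ?r (Suc j mod n)"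
      using f False by (simp add: cyclic_enum_def)
    then show ?thesis
      using eq that False by simp
  qed
  ultimately show ?thesis
    by (simp add: cyclic_enum_def o_def)
qed (use f in \<open>simp add: cyclic_enum_def bij_betw_def\<close>)

lemma arcs_ends_del_vert:
  "arcs_ends (pre_digraph.del_vert G x) = {(u, v). u \<rightarrow>\<^bsub>G\<^esub> v \<and> u \<noteq> x \<and> v \<noteq> x}"
  by (auto simp: arcs_ends_conv pre_digraph.del_vert_simps)

lemma (in graph) graph_del_vert: "graph (del_vert x)"
proof -
  interpret H: fin_digraph "del_vert x"
    by (rule fin_digraph_del_vert)
  show ?thesis
  proof unfold_locales
    show "symmetric (del_vert x)"
      using arcs_ends_symmetric[OF sym_arcs]
      by (auto simp: symmetric_def sym_def arcs_ends_del_vert)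
  qed (auto simp: del_vert_simps ends_del_vert no_loops dest: no_multi_arcs)
qed

text \<open>Connectedness is defined through the symmetric closure, which adds nothing to a
  symmetric digraph.\<close>

lemma (in graph) connected_iff_reachable:
  "Digraph_Component.connected G \<longleftrightarrow> verts G \<noteq> {} \<and> (\<forall>u\<in>verts G. \<forall>v\<in>verts G. u \<rightarrow>\<^sup>*\<^bsub>G\<^esub> v)"
proof -
  have "(arcs_ends G)\<^sup>s = arcs_ends G"
    using arcs_ends_symmetric[OF sym_arcs] by (auto simp: symcl_def)
  then show ?thesis
    by (simp add: connected_conv reachable_def)
qed

lemma (in graph) connectedI_enum:
  assumes "0 < n" and img: "f ` {..<n} = verts G" and step: "\<And>i. Suc i < n \<Longrightarrow> f i \<rightarrow>\<^bsub>G\<^esub> f (Suc i)"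
  shows "Digraph_Component.connected G"
proof -
  have "f 0 \<rightarrow>\<^sup>*\<^bsub>G\<^esub> f i" if "i < n" for i
    using that
  proof (induction i)
    case 0
    then show ?case using img by auto
  next
    case (Suc i)
    then show ?case using step[of i] by (auto intro: reachable_adj_trans)
  qed
  then have base: "f 0 \<rightarrow>\<^sup>*\<^bsub>G\<^esub> v" if "v \<in> verts G" for v
    using that unfolding img[symmetric] by auto
  have "u \<rightarrow>\<^sup>*\<^bsub>G\<^esub> v" if "u \<in> verts G" "v \<in> verts G" for u v
    using symmetric_reachable'[OF base[OF that(1)]] base[OF that(2)] by (rule reachable_trans)
  then show ?thesis
    unfolding connected_iff_reachable using img \<open>0 < n\<close> by auto
qed

text \<open>Both arcs that wrap around modulo \<open>n\<close> are incident to the last vertex;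
  among the smaller indices \<open>Suc i mod n\<close> is just \<open>Suc i\<close>.\<close>

lemma (in graph) path_enum_del_vert:
  assumes f: "cyclic_enum G n f" and n: "2 \<le> n"
  shows "path_enum (del_vert (f (n - 1))) (n - 1) f"
proof -
  have inj: "inj_on f {..<n}" and img: "f ` {..<n} = verts G"
    using f by (auto simp: cyclic_enum_def bij_betw_def)
  have "{..<n} = insert (n - 1) {..<n - 1}"
    using n by auto
  then have "verts G = insert (f (n - 1)) (f ` {..<n - 1})"
    by (simp flip: img)
  moreover have ne: "f i \<noteq> f (n - 1)" if "i < n - 1" for i
  proof -
    have "i < n" "i \<noteq> n - 1" "n - 1 < n" using that by auto
    then show ?thesis using inj by (auto simp: inj_on_def)
  qed
  ultimately have "f ` {..<n - 1} = verts G - {f (n - 1)}"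
    by auto
  moreover have "inj_on f {..<n - 1}"
    using inj by (rule inj_on_subset) auto
  ultimately have "bij_betw f {..<n - 1} (verts (del_vert (f (n - 1))))"
    by (simp add: bij_betw_def del_vert_simps)
  then show ?thesis
    using f ne by (auto simp: path_enum_def cyclic_enum_def arcs_ends_del_vert)
qed

lemma (in graph) good_vertex_cyclic_iff:
  assumes f: "cyclic_enum G n f" and n: "3 \<le> n" and v: "v \<in> verts G"
  shows "good_vertex G v \<longleftrightarrow> n = 5"
proof -
  have "f ` {..<n} = verts G"
    using f by (auto simp: cyclic_enum_def bij_betw_def)
  then obtain k where k: "k < n" "v = f k"
    using v by blast
  \<comment> \<open>The shift by \<open>Suc k\<close> puts \<open>v\<close> at the last index
    \<open>n - 1\<close>, so that deleting it leaves an initial segment.\<close>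
  define g where "g i = f ((i + Suc k) mod n)" for i
  have g: "cyclic_enum G n g"
    unfolding g_def by (rule cyclic_enum_rotate[OF f])
  have "n - 1 + Suc k = k + n" using n by simp
  then have gv: "g (n - 1) = v"
    using k by (simp add: g_def)
  interpret H: graph "del_vert v"
    by (rule graph_del_vert)
  have p: "path_enum (del_vert v) (n - 1) g"
    using path_enum_del_vert[OF g] n gv by simp
  have "Digraph_Component.connected (del_vert v)"
    using p n by (intro H.connectedI_enum[of "n - 1" g]) (auto simp: path_enum_def bij_betw_def)
  then have "good_vertex G v \<longleftrightarrow>
      real n * ((real n)\<^sup>2 - 1) / 12 = real (n - 1) * ((real (n - 1))\<^sup>2 - 1) / 6"
    by (simp add: good_vertex_def kirchhoff_index_cyclic[OF f n] H.kirchhoff_index_path[OF p])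
  \<comment> \<open>The common factor \<open>n (n - 1) / 12\<close> leaves
    \<open>(n + 1) - 2 (n - 2) = 5 - n\<close>.\<close>
  also have "real n * ((real n)\<^sup>2 - 1) / 12 = real (n - 1) * ((real (n - 1))\<^sup>2 - 1) / 6 \<longleftrightarrow>
      real n * (real n - 1) * (5 - real n) = 0"
  proof -
    have "real n * ((real n)\<^sup>2 - 1) / 12 - real (n - 1) * ((real (n - 1))\<^sup>2 - 1) / 6 =
        real n * (real n - 1) * (5 - real n) / 12"
      using n by (simp add: of_nat_diff field_simps power2_eq_square)
    then show ?thesis by (metis (no_types) divide_eq_0_iff eq_iff_diff_eq_0 zero_neq_numeral)
  qed
  also have "\<dots> \<longleftrightarrow> n = 5"
    using n by auto
  finally show ?thesis .
qed

section \<open>Unicyclic graphs\<close>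

lemma (in wf_digraph) cas_map_upt:
  assumes "\<And>i. i < m \<Longrightarrow> tail G (e i) = g i \<and> head G (e i) = g (Suc i)"
  shows "cas (g 0) (map e [0..<m]) (g m)"
  using assms
proof (induction m)
  case (Suc m)
  then have "cas (g 0) (map e [0..<m]) (g m)" by simp
  moreover from this have "awlast (g 0) (map e [0..<m]) = g m"
    by (rule awlast_if_cas)
  ultimately show ?case
    using Suc.prems[of m] by simp
qed simp

text \<open>Replaces lists of arcs by injective cyclic sequences of vertices, the form in which
  cycles are compared and constructed below.\<close>

lemma (in wf_digraph) undirected_cycles_iff:
  "E \<in> undirected_cycles G \<longleftrightarrow>
    (\<exists>n f. 3 \<le> n \<and> inj_on f {..<n} \<and> (\<forall>i<n. f i \<rightarrow>\<^bsub>G\<^esub> f (Suc i mod n)) \<and>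
      E = (\<lambda>i. {f i, f (Suc i mod n)}) ` {..<n})"
proof
  assume "E \<in> undirected_cycles G"
  then obtain p u where p: "awalk u p u" "distinct (tl (awalk_verts u p))" "3 \<le> length p"
    and E: "E = (\<lambda>e. {tail G e, head G e}) ` set p"
    by (auto simp: undirected_cycles_def cycle_def)
  let ?n = "length p"
  define f where "f i = tail G (p ! i)" for i
  have "p \<noteq> []" using p by auto
  have cas: "cas u p u" using p by auto
  \<comment> \<open>Two readings of the vertex list of the walk. Comparing entries at
    \<open>Suc i\<close> shows that the head of each arc is the tail of the next one.\<close>
  have verts: "map (tail G) p @ [head G (last p)] = tail G (hd p) # map (head G) p"
    using awalk_verts_conv[of u p] awalk_verts_conv'[OF cas] \<open>p \<noteq> []\<close> by simp
  have head: "head G (p ! i) = f (Suc i mod ?n)" if "i < ?n" for i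
  proof (cases "Suc i = ?n")
    case True
    have "head G (last p) = u" "tail G (hd p) = u"
      using p(1) cas awalk_verts_conv[of u p] cas_simp[OF \<open>p \<noteq> []\<close>] \<open>p \<noteq> []\<close>
      by (auto dest: awlast_of_awalk)
    moreover have "last p = p ! i"
      using True \<open>p \<noteq> []\<close> by (simp add: last_conv_nth flip: True)
    ultimately show ?thesis
      using True \<open>p \<noteq> []\<close> by (simp add: f_def hd_conv_nth)
  next
    case False
    then have "(map (tail G) p @ [head G (last p)]) ! Suc i = tail G (p ! Suc i)"
      using that by (simp add: nth_append)
    moreover have "(tail G (hd p) # map (head G) p) ! Suc i = head G (p ! i)"
      using that by simp
    ultimately show ?thesis
      using verts that False by (simp add: f_def)
  qed
  have dist: "distinct (map (head G) p)"
    using p(2) awalk_verts_conv'[OF cas] \<open>p \<noteq> []\<close> by simp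
  \<comment> \<open>Distinctness is known for the heads; stepping back by one index transfers it to
    the tails, which define \<open>f\<close>.\<close>
  have "inj_on f {..<?n}"
  proof (rule inj_onI)
    fix i j assume ij: "i \<in> {..<?n}" "j \<in> {..<?n}" and eq: "f i = f j"
    obtain k l where kl: "k < ?n" "Suc k mod ?n = i" "l < ?n" "Suc l mod ?n = j"
      using ij by (meson ex_Suc_mod_eq lessThan_iff)
    then have "head G (p ! k) = head G (p ! l)"
      using head eq by simp
    with dist kl have "k = l"
      by (simp add: distinct_conv_nth) metis
    with kl show "i = j" by simp
  qed
  moreover have "f i \<rightarrow>\<^bsub>G\<^esub> f (Suc i mod ?n)" if "i < ?n" for i
  proof -
    have "p ! i \<in> arcs G" using p(1) that by (auto simp: awalk_def)
    then show ?thesis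
      using head[OF that] by (auto simp: f_def arcs_ends_conv image_iff)
  qed
  moreover have "E = (\<lambda>i. {f i, f (Suc i mod ?n)}) ` {..<?n}"
  proof -
    have "E = (\<lambda>i. {tail G (p ! i), head G (p ! i)}) ` {..<?n}"
      unfolding E by (auto simp: set_conv_nth)
    then show ?thesis
      using head by (auto simp: f_def)
  qed
  ultimately show "\<exists>n f. 3 \<le> n \<and> inj_on f {..<n} \<and> (\<forall>i<n. f i \<rightarrow>\<^bsub>G\<^esub> f (Suc i mod n)) \<and>
      E = (\<lambda>i. {f i, f (Suc i mod n)}) ` {..<n}"
    using p(3) by blast
next
  assume "\<exists>n f. 3 \<le> n \<and> inj_on f {..<n} \<and> (\<forall>i<n. f i \<rightarrow>\<^bsub>G\<^esub> f (Suc i mod n)) \<and>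
      E = (\<lambda>i. {f i, f (Suc i mod n)}) ` {..<n}"
  then obtain n f where n: "3 \<le> n" and inj: "inj_on f {..<n}"
    and adj: "\<And>i. i < n \<Longrightarrow> f i \<rightarrow>\<^bsub>G\<^esub> f (Suc i mod n)"
    and E: "E = (\<lambda>i. {f i, f (Suc i mod n)}) ` {..<n}"
    by blast
  have "\<exists>a. i < n \<longrightarrow> a \<in> arcs G \<and> tail G a = f i \<and> head G a = f (Suc i mod n)" for i
    using adj[of i] by (cases "i < n") auto
  then obtain e where e: "\<And>i. i < n \<Longrightarrow> e i \<in> arcs G \<and> tail G (e i) = f i \<and> head G (e i) = f (Suc i mod n)"
    by metis
  let ?p = "map e [0..<n]"
  \<comment> \<open>Reading indices modulo \<open>n\<close> makes the chain return to
    \<open>f 0\<close> after \<open>n\<close> arcs.\<close>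
  have "cas (f (0 mod n)) ?p (f (n mod n))"
    using e by (intro cas_map_upt[where g = "\<lambda>i. f (i mod n)"]) auto
  then have cas: "cas (f 0) ?p (f 0)"
    by simp
  have "f 0 \<in> verts G"
    using adj[of 0] n by (auto dest: adj_in_verts)
  with cas e have "awalk (f 0) ?p (f 0)"
    by (auto simp: awalk_def)
  moreover have "distinct (tl (awalk_verts (f 0) ?p))"
  proof -
    have "inj_on (f \<circ> (\<lambda>i. Suc i mod n)) {..<n}"
      using n by (intro comp_inj_on inj_on_Suc_mod inj_on_subset[OF inj]) auto
    then have "distinct (map (\<lambda>i. f (Suc i mod n)) [0..<n])"
      by (simp add: distinct_map lessThan_atLeast0 o_def)
    moreover have "tl (awalk_verts (f 0) ?p) = map (\<lambda>i. f (Suc i mod n)) [0..<n]"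
      using awalk_verts_conv'[OF cas] n e by simp
    ultimately show ?thesis by simp
  qed
  ultimately have "cycle ?p"
    using n by (auto simp: cycle_def)
  moreover have "E = (\<lambda>e. {tail G e, head G e}) ` set ?p"
    unfolding E using e by (auto simp: image_image)
  ultimately show "E \<in> undirected_cycles G"
    unfolding undirected_cycles_def using n by (intro CollectI exI[of _ ?p]) auto
qed

text \<open>A path from \<open>w\<close> to \<open>c'\<close> that avoids \<open>c\<close> closes up to a cycle through \<open>c\<close>.\<close>

lemma (in graph) edge_in_undirected_cycle:
  assumes w: "c \<rightarrow>\<^bsub>G\<^esub> w" and c': "c \<rightarrow>\<^bsub>G\<^esub> c'" and ne: "w \<noteq> c'"
    and conn: "Digraph_Component.connected (del_vert c)"
  shows "\<exists>E\<in>undirected_cycles G. {c, w} \<in> E"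
proof -
  interpret H: graph "del_vert c"
    by (rule graph_del_vert)
  have "w \<in> verts (del_vert c)" "c' \<in> verts (del_vert c)"
    using w c' adj_not_same by (auto simp: del_vert_simps dest: adj_in_verts)
  then have "w \<rightarrow>\<^sup>*\<^bsub>del_vert c\<^esub> c'"
    using conn by (auto simp: H.connected_iff_reachable)
  then obtain q where q: "H.apath w q c'"
    by (auto simp: H.reachable_apath)
  have q_ne: "q \<noteq> []"
    using q ne by (auto simp: H.apath_Nil_iff)
  define vs where "vs = H.awalk_verts w q"
  have walk: "H.awalk w q c'" and dist: "distinct vs"
    using q by (auto simp: H.apath_def vs_def)
  have len: "length vs = Suc (length q)"
    by (simp add: vs_def H.length_awalk_verts)
  have "hd vs = w" and last: "last vs = c'"
    using walk by (auto simp: vs_def)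
  then have hd: "vs ! 0 = w"
    using len by (cases vs) auto
  have in_H: "set vs \<subseteq> verts (del_vert c)"
    using walk by (auto simp: vs_def)
  have step: "vs ! i \<rightarrow>\<^bsub>G\<^esub> vs ! Suc i" if "i < length q" for i
  proof -
    have "vs ! i = tail G (q ! i)"
      using that q_ne by (simp add: vs_def H.awalk_verts_conv nth_append tail_del_vert)
    moreover have "vs ! Suc i = head G (q ! i)"
      using that q_ne walk H.awalk_verts_conv'[of w q c']
      by (auto simp: vs_def head_del_vert H.awalk_def)
    moreover have "q ! i \<in> arcs G"
      using walk that by (auto simp: H.awalk_def arcs_del_vert dest: nth_mem)
    ultimately show ?thesis
      by (auto simp: arcs_ends_conv image_iff)
  qed
  \<comment> \<open>The cycle is \<open>c\<close> followed by the path from \<open>w\<close> to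
    \<open>c'\<close>. As \<open>w\<close> and \<open>c'\<close> differ, the path has at least two
    vertices, whence length at least 3.\<close>
  let ?n = "Suc (length vs)" and ?f = "(!) (c # vs)"
  have "3 \<le> ?n"
    using len q_ne by (cases q) auto
  moreover have "inj_on ?f {..<?n}"
    using dist in_H by (intro inj_on_nth) (auto simp: del_vert_simps)
  moreover have "?f i \<rightarrow>\<^bsub>G\<^esub> ?f (Suc i mod ?n)" if "i < ?n" for i
  proof (cases i)
    case 0
    then show ?thesis
      using w hd len by simp
  next
    case (Suc k)
    show ?thesis
    proof (cases "i = length vs")
      case True
      have "c' \<rightarrow>\<^bsub>G\<^esub> c"
        using c' arcs_ends_symmetric[OF sym_arcs] by blast
      moreover have "vs ! k = c'"
        using last len True Suc by (subst (asm) last_conv_nth) auto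
      ultimately have "?f i \<rightarrow>\<^bsub>G\<^esub> c"
        using Suc by simp
      then show ?thesis
        using True by simp
    next
      case False
      then show ?thesis
        using that Suc step[of k] len by simp
    qed
  qed
  ultimately have "(\<lambda>i. {?f i, ?f (Suc i mod ?n)}) ` {..<?n} \<in> undirected_cycles G"
    unfolding undirected_cycles_iff by blast
  moreover have "{c, w} \<in> (\<lambda>i. {?f i, ?f (Suc i mod ?n)}) ` {..<?n}"
    using hd len by (intro image_eqI[of _ _ 0]) auto
  ultimately show ?thesis by (rule bexI[rotated])
qed

lemma (in wf_digraph) reachable_closed:
  assumes "u \<rightarrow>\<^sup>*\<^bsub>G\<^esub> v" "u \<in> S" "\<And>x y. x \<in> S \<Longrightarrow> x \<rightarrow>\<^bsub>G\<^esub> y \<Longrightarrow> y \<in> S"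
  shows "v \<in> S"
  using assms(1)
proof (induction rule: reachable_induct)
  case (step x y)
  then show ?case using assms(3) by blast
qed (use assms(2) in simp)

lemma (in graph) unicyclic_imp_cyclic_enum:
  assumes uni: "unicyclic G"
    and conn: "\<And>v. v \<in> verts G \<Longrightarrow> Digraph_Component.connected (del_vert v)"
  shows "\<exists>n f. 3 \<le> n \<and> cyclic_enum G n f"
proof -
  obtain E where "E \<in> undirected_cycles G"
    and unique: "\<And>E'. E' \<in> undirected_cycles G \<Longrightarrow> E' = E"
    using uni by (auto simp: unicyclic_def)
  then obtain n f where n: "3 \<le> n" and inj: "inj_on f {..<n}"
    and adj: "\<And>i. i < n \<Longrightarrow> f i \<rightarrow>\<^bsub>G\<^esub> f (Suc i mod n)"
    and E: "E = (\<lambda>i. {f i, f (Suc i mod n)}) ` {..<n}"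
    unfolding undirected_cycles_iff by blast
  have f_eq: "f i = f j \<longleftrightarrow> i = j" if "i < n" "j < n" for i j
    using inj that by (auto simp: inj_on_def)
  have mod_less: "Suc i mod n < n" for i
    using n by simp
  have nbr: "w = f (Suc i mod n) \<or> (\<exists>k<n. Suc k mod n = i \<and> w = f k)"
    if i: "i < n" and w: "f i \<rightarrow>\<^bsub>G\<^esub> w" for i w
  proof (cases "w = f (Suc i mod n)")
    case False
    have "Digraph_Component.connected (del_vert (f i))"
      using conn w adj_in_verts by blast
    then have "{f i, w} \<in> E"
      using edge_in_undirected_cycle[OF w adj[OF i] False] unique by blast
    \<comment> \<open>Either \<open>f i\<close> is \<open>f k\<close>, making \<open>w\<close> the
      excluded successor, or \<open>f i\<close> follows \<open>f k\<close> and \<open>w\<close> is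
      the predecessor \<open>f k\<close>.\<close>
    then obtain k where k: "k < n" "{f i, w} = {f k, f (Suc k mod n)}"
      unfolding E by blast
    then show ?thesis
      using f_eq[OF i k(1)] f_eq[OF i mod_less] False by (auto simp: doubleton_eq_iff)
  qed simp
  \<comment> \<open>No edge leaves the cycle, so by connectedness it contains every vertex.\<close>
  have closed: "y \<in> f ` {..<n}" if "x \<in> f ` {..<n}" "x \<rightarrow>\<^bsub>G\<^esub> y" for x y
    using that nbr mod_less by blast
  have "f ` {..<n} = verts G"
  proof
    show "f ` {..<n} \<subseteq> verts G"
      using adj adj_in_verts by blast
    show "verts G \<subseteq> f ` {..<n}"
    proof
      fix v assume "v \<in> verts G"
      then have "f 0 \<rightarrow>\<^sup>*\<^bsub>G\<^esub> v"
        using uni adj[of 0] n adj_in_verts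
        by (auto simp: unicyclic_def connected_iff_reachable)
      then show "v \<in> f ` {..<n}"
        by (rule reachable_closed) (use n closed in auto)
    qed
  qed
  moreover have "f i \<rightarrow>\<^bsub>G\<^esub> f j \<longleftrightarrow> j = Suc i mod n \<or> i = Suc j mod n" if ij: "i < n" "j < n" for i j
  proof
    assume "f i \<rightarrow>\<^bsub>G\<^esub> f j"
    from nbr[OF ij(1) this] show "j = Suc i mod n \<or> i = Suc j mod n"
      using f_eq ij mod_less by auto
  next
    assume "j = Suc i mod n \<or> i = Suc j mod n"
    then show "f i \<rightarrow>\<^bsub>G\<^esub> f j"
      using adj[of i] adj[of j] ij arcs_ends_symmetric[OF sym_arcs] by blast
  qed
  ultimately have "cyclic_enum G n f"
    using inj by (simp add: cyclic_enum_def bij_betw_def)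
  then show ?thesis using n by blast
qed

text \<open>Every vertex has at most two neighbours, and a cycle through it already uses two. Hence
  no edge at a vertex of a cycle is missed by that cycle, and connectedness forces any cycle to
  consist of all edges of \<open>G\<close>.\<close>

lemma (in graph) cyclic_enum_imp_unicyclic:
  assumes f: "cyclic_enum G n f" and n: "3 \<le> n"
  shows "unicyclic G"
proof -
  have inj: "inj_on f {..<n}" and img: "f ` {..<n} = verts G"
    and adj: "\<And>i j. i < n \<Longrightarrow> j < n \<Longrightarrow> f i \<rightarrow>\<^bsub>G\<^esub> f j \<longleftrightarrow> j = Suc i mod n \<or> i = Suc j mod n"
    using f by (auto simp: cyclic_enum_def bij_betw_def)
  have conn: "Digraph_Component.connected G"
    using n img adj by (intro connectedI_enum[of n f]) auto
  have "(\<lambda>i. {f i, f (Suc i mod n)}) ` {..<n} \<in> undirected_cycles G"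
    unfolding undirected_cycles_iff using n inj adj by (intro exI[of _ n] exI[of _ f]) auto
  moreover have "E = {{u, v} | u v. u \<rightarrow>\<^bsub>G\<^esub> v}" if "E \<in> undirected_cycles G" for E
  proof -
    from that obtain m g where m: "3 \<le> m" and g_inj: "inj_on g {..<m}"
      and g_adj: "\<And>k. k < m \<Longrightarrow> g k \<rightarrow>\<^bsub>G\<^esub> g (Suc k mod m)"
      and E: "E = (\<lambda>i. {g i, g (Suc i mod m)}) ` {..<m}"
      unfolding undirected_cycles_iff by blast
    have mod_less: "Suc k mod m < m" for k
      using m by simp
    have nbr: "w \<in> g ` {..<m} \<and> {g k, w} \<in> E" if k: "k < m" and w: "g k \<rightarrow>\<^bsub>G\<^esub> w" for k w
    proof -
      obtain l where l: "l < m" "Suc l mod m = k"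
        using ex_Suc_mod_eq[OF k] .
      let ?s = "g (Suc k mod m)"
      have "Suc k mod m \<noteq> l"
        using k l m by (auto simp: Suc_mod_eq_if split: if_splits)
      then have ne: "?s \<noteq> g l"
        using g_inj mod_less l by (auto simp: inj_on_def)
      have "g l \<rightarrow>\<^bsub>G\<^esub> g k"
        using g_adj[OF l(1)] l by simp
      then have gl: "g k \<rightarrow>\<^bsub>G\<^esub> g l"
        using arcs_ends_symmetric[OF sym_arcs] by blast
      have "g k \<in> verts G"
        using w adj_in_verts by blast
      then obtain i where i: "i < n" "g k = f i"
        using img by (metis imageE lessThan_iff)
      obtain j where j: "j < n" "Suc j mod n = i"
        using ex_Suc_mod_eq[OF i(1)] .
      \<comment> \<open>Applied below to \<open>w\<close> and to the two distinct neighbours of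
        \<open>g k\<close> along the given cycle: three members of a set of at most two elements, so
        \<open>w\<close> is one of those neighbours.\<close>
      have "x \<in> {f (Suc i mod n), f j}" if "g k \<rightarrow>\<^bsub>G\<^esub> x" for x
      proof -
        have "x \<in> f ` {..<n}"
          using that adj_in_verts img by blast
        then obtain a where a: "a < n" "x = f a" by blast
        then have "a = Suc i mod n \<or> Suc j mod n = Suc a mod n"
          using adj[OF i(1) a(1)] that i j by auto
        then show ?thesis
          using inj_onD[OF inj_on_Suc_mod, of j n a] a j by auto
      qed
      from this[OF w] this[OF gl] this[OF g_adj[OF k]] ne
      have "w = ?s \<or> w = g l" by auto
      moreover have "{g k, ?s} \<in> E" "{g k, g l} \<in> E"
        unfolding E using k l by (auto simp: insert_commute)
      ultimately show ?thesis
        using l mod_less by auto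
    qed
    have "verts G \<subseteq> g ` {..<m}"
    proof
      fix v assume "v \<in> verts G"
      then have "g 0 \<rightarrow>\<^sup>*\<^bsub>G\<^esub> v"
        using conn g_adj[of 0] m adj_in_verts by (auto simp: connected_iff_reachable)
      then show "v \<in> g ` {..<m}"
        by (rule reachable_closed) (use m nbr in auto)
    qed
    then have "{u, v} \<in> E" if "u \<rightarrow>\<^bsub>G\<^esub> v" for u v
      using that nbr adj_in_verts(1)[OF that] by auto
    moreover have "\<exists>u v. e = {u, v} \<and> u \<rightarrow>\<^bsub>G\<^esub> v" if "e \<in> E" for e
      using that g_adj unfolding E by blast
    ultimately show ?thesis by blast
  qed
  ultimately show ?thesis
    unfolding unicyclic_def using conn by blast
qed

section \<open>Isomorphism with the standard cycle, and the theorem\<close>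

lemma arcs_ends_cycle_graph:
  "arcs_ends (cycle_graph n) =
    {(i, j). i < n \<and> j < n \<and> (j = Suc i mod n \<or> i = Suc j mod n)}"
  by (simp add: cycle_graph_def)

text \<open>Without parallel arcs an arc is determined by its ends, so a bijection of the vertices
  that respects adjacency extends to the arcs.\<close>

lemma (in graph) digraph_iso_cycle_graph_iff:
  "digraph_iso G (cycle_graph n) \<longleftrightarrow> (\<exists>f. cyclic_enum G n f)"
proof
  assume "digraph_iso G (cycle_graph n)"
  then obtain hom where hom: "digraph_isomorphism hom" and H: "cycle_graph n = app_iso hom G"
    by (auto simp: digraph_iso_def)
  let ?h = "iso_verts hom"
  have inj: "inj_on ?h (verts G)"
    using hom by (rule digraph_isomorphism_inj_on_verts)
  have img: "?h ` verts G = {..<n}"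
    using arg_cong[OF H, of verts] by (simp add: cycle_graph_def)
  have bij: "bij_betw ?h (verts G) {..<n}"
    using inj img by (simp add: bij_betw_def)
  define f where "f = the_inv_into (verts G) ?h"
  have f: "bij_betw f {..<n} (verts G)"
    unfolding f_def using bij by (rule bij_betw_the_inv_into)
  have hf: "?h (f i) = i" if "i < n" for i
    unfolding f_def using bij that by (simp add: f_the_inv_into_f_bij_betw)
  have "f i \<rightarrow>\<^bsub>G\<^esub> f j \<longleftrightarrow> (i, j) \<in> arcs_ends (cycle_graph n)" if ij: "i < n" "j < n" for i j
  proof -
    have mem: "f i \<in> verts G" "f j \<in> verts G"
      using f ij by (auto simp: bij_betw_def)
    have "(i, j) \<in> arcs_ends (cycle_graph n) \<longleftrightarrow>
        (\<exists>u v. u \<rightarrow>\<^bsub>G\<^esub> v \<and> i = ?h u \<and> j = ?h v)"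
      unfolding H arcs_ends_app_iso_eq[OF hom] by auto
    also have "\<dots> \<longleftrightarrow> f i \<rightarrow>\<^bsub>G\<^esub> f j"
      using hf[OF ij(1)] hf[OF ij(2)] inj mem adj_in_verts by (metis inj_onD)
    finally show ?thesis ..
  qed
  then show "\<exists>f. cyclic_enum G n f"
    using f by (auto simp: cyclic_enum_def arcs_ends_cycle_graph)
next
  assume "\<exists>f. cyclic_enum G n f"
  then obtain f where bij: "bij_betw f {..<n} (verts G)"
    and adj: "\<And>i j. i < n \<Longrightarrow> j < n \<Longrightarrow> f i \<rightarrow>\<^bsub>G\<^esub> f j \<longleftrightarrow> j = Suc i mod n \<or> i = Suc j mod n"
    by (auto simp: cyclic_enum_def)
  define h where "h = the_inv_into {..<n} f"
  have h: "bij_betw h (verts G) {..<n}"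
    unfolding h_def using bij by (rule bij_betw_the_inv_into)
  have h_inj: "inj_on h (verts G)" and h_img: "h ` verts G = {..<n}"
    using h by (auto simp: bij_betw_def)
  have fh: "f (h v) = v" if "v \<in> verts G" for v
    unfolding h_def using bij that by (simp add: f_the_inv_into_f_bij_betw)
  have hf: "h (f i) = i" if "i < n" for i
    unfolding h_def using bij that by (simp add: bij_betw_def the_inv_into_f_f)
  \<comment> \<open>The image of \<open>G\<close> has to equal \<open>cycle_graph n\<close>
    literally. The arcs there are pairs with projections as tail and head, which dictates
    \<open>?a\<close>, \<open>fst\<close> and \<open>snd\<close>.\<close>
  let ?a = "\<lambda>e. (h (tail G e), h (head G e))"
  let ?hom = "\<lparr>iso_verts = h, iso_arcs = ?a, iso_head = snd, iso_tail = fst\<rparr>"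
  have "inj_on ?a (arcs G)"
    using h_inj by (auto simp: inj_on_def arc_to_ends_def intro!: no_multi_arcs)
  then have "digraph_isomorphism ?hom"
    using h_inj by (simp add: digraph_isomorphism_def wf_digraph)
  moreover have "?a ` arcs G = arcs_ends (cycle_graph n)"
  proof -
    have "?a ` arcs G = (\<lambda>(u, v). (h u, h v)) ` arcs_ends G"
      by (auto simp: arcs_ends_conv image_iff)
    also have "\<dots> = {(i, j). i < n \<and> j < n \<and> f i \<rightarrow>\<^bsub>G\<^esub> f j}"
    proof safe
      fix u v assume uv: "u \<rightarrow>\<^bsub>G\<^esub> v"
      then have "u \<in> verts G" "v \<in> verts G" by (auto dest: adj_in_verts)
      then show "h u < n" "h v < n" "f (h u) \<rightarrow>\<^bsub>G\<^esub> f (h v)"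
        using h_img fh uv by auto
    next
      fix i j assume "i < n" "j < n" "f i \<rightarrow>\<^bsub>G\<^esub> f j"
      then show "(i, j) \<in> (\<lambda>(u, v). (h u, h v)) ` arcs_ends G"
        using hf by (intro image_eqI[of _ _ "(f i, f j)"]) auto
    qed
    finally show ?thesis
      using adj by (auto simp: arcs_ends_cycle_graph)
  qed
  then have "cycle_graph n = app_iso ?hom G"
    using h_img by (simp add: app_iso_def cycle_graph_def with_proj_def arcs_ends_conv)
  ultimately show "digraph_iso G (cycle_graph n)"
    by (auto simp: digraph_iso_def)
qed

theorem mainTheorem2:
  fixes G :: "('a, 'b) pre_digraph"
  assumes "graph G"
  shows "unicyclic G \<and> kirchhoff_soltes_graph G \<longleftrightarrow> digraph_iso G (cycle_graph 5)"
proof -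
  interpret graph G by (rule assms)
  show ?thesis
    unfolding digraph_iso_cycle_graph_iff
  proof
    assume G: "unicyclic G \<and> kirchhoff_soltes_graph G"
    then obtain n f where n: "3 \<le> n" and f: "cyclic_enum G n f"
      using unicyclic_imp_cyclic_enum
      by (auto simp: kirchhoff_soltes_graph_def good_vertex_def)
    \<comment> \<open>A single good vertex already determines \<open>n\<close>.\<close>
    have "f 0 \<in> verts G"
      using f n by (auto simp: cyclic_enum_def bij_betw_def)
    then have "n = 5"
      using G good_vertex_cyclic_iff[OF f n] by (auto simp: kirchhoff_soltes_graph_def)
    then show "\<exists>f. cyclic_enum G 5 f"
      using f by blast
  next
    assume "\<exists>f. cyclic_enum G 5 f"
    then obtain f where "cyclic_enum G 5 f" ..
    then show "unicyclic G \<and> kirchhoff_soltes_graph G"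
      using cyclic_enum_imp_unicyclic good_vertex_cyclic_iff
      by (force simp: kirchhoff_soltes_graph_def)
  qed
qed

end
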